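(* Let $\gamma,\sigma,\beta\in C[0,\infty)$ be real-valued functions and let $v:[0,\infty)\to[0,\infty)$ be a nonnegative differentiable function satisfying $$\dot v(t)\le -\gamma(t)v(t)+\sigma(t)v^2(t)+\beta(t),\qquad t\ge 0.$$ Suppose there exists a positive function $\mu\in C^1[0,\infty)$ such that for all $t\ge 0$ $$0\le\sigma(t)\le\frac{\mu(t)}{2}\left(\gamma(t)-\frac{\dot\mu(t)}{\mu(t)}\right),\qquad \beta(t)\le\frac{1}{2\mu(t)}\left(\gamma(t)-\frac{\dot\mu(t)}{\mu(t)}\right),$$ and $\mu(0)v(0)<1$. Then $$v(t)<\frac{1}{\mu(t)}\qquad\text{for all } t\ge 0.$$
   Context: A dot denotes the derivative with respect to $t$. *)

theory Defs imports Complex_Main begin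

end

theory Submission imports Defs begin

text \<open>With \<open>a = \<gamma> - \<mu>' / \<mu> \<ge> 0\<close> the hypotheses say that \<open>u = 1 - \<mu> v \<le> 1\<close> satisfies
  \<open>u' \<ge> - (a / 2) u\<^sup>2\<close>. As long as \<open>u\<close> is positive, \<open>u\<^sup>2 \<le> u\<close>, so on a compact interval
  \<open>u' \<ge> - K u\<close> for a constant \<open>K\<close>, and \<open>u(t) e\<^sup>K\<^sup>t\<close> is nondecreasing up to the first
  zero of \<open>u\<close>, which therefore cannot exist.\<close>

text \<open>By continuity, the points of \<open>{a..b}\<close> with \<open>u \<le> 0\<close> form a
  compact set, nonempty because it contains \<open>b\<close>; its minimum is the required
  \<open>c\<close>.\<close>

lemma first_nonpos_point:
  fixes u :: "real \<Rightarrow> real"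
  assumes cont: "continuous_on {a..b} u" and "u b \<le> 0" and "a \<le> b"
  obtains c where "c \<in> {a..b}" and "u c \<le> 0" and "\<And>s. a \<le> s \<Longrightarrow> s < c \<Longrightarrow> u s > 0"
proof -
  define S where "S = u -` {..0} \<inter> {a..b}"
  have "closed S"
    using cont continuous_on_closed_vimage[of "{a..b}" u] unfolding S_def by auto
  then have "compact ({a..b} \<inter> S)"
    by (intro compact_Int_closed compact_Icc)
  moreover have "{a..b} \<inter> S = S"
    by (auto simp: S_def)
  moreover have "S \<noteq> {}"
    using assms by (auto simp: S_def)
  ultimately obtain c where c: "c \<in> S" and min: "\<And>s. s \<in> S \<Longrightarrow> c \<le> s"
    using compact_attains_inf[of S] by auto
  show thesis
  proof (rule that)
    show "c \<in> {a..b}" "u c \<le> 0"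
      using c by (auto simp: S_def)
    show "u s > 0" if "a \<le> s" "s < c" for s
      using that c min[of s] by (force simp: S_def)
  qed
qed

text \<open>A Gronwall-type comparison. \<open>bound\<close> is demanded only where \<open>u\<close>
  is positive, which suffices because the argument stops at the first point with
  \<open>u \<le> 0\<close>. Derivatives are taken only in the open interval, so a one-sided
  derivative at \<open>a\<close> does no harm.\<close>

lemma positive_of_linear_lower_bound:
  fixes u u' :: "real \<Rightarrow> real"
  assumes cont: "continuous_on {a..b} u" and "a \<le> b" and "u a > 0"
    and deriv: "\<And>t. a < t \<Longrightarrow> t < b \<Longrightarrow> (u has_real_derivative u' t) (at t)"
    and bound: "\<And>t. a < t \<Longrightarrow> t < b \<Longrightarrow> u t > 0 \<Longrightarrow> u' t \<ge> - K * u t"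
  shows "u b > 0"
proof (rule ccontr)
  assume "\<not> u b > 0"
  then obtain c where c: "c \<in> {a..b}" "u c \<le> 0" and pos: "\<And>s. a \<le> s \<Longrightarrow> s < c \<Longrightarrow> u s > 0"
    using first_nonpos_point[OF cont _ \<open>a \<le> b\<close>] by (auto simp: not_less)
  \<comment> \<open>The integrating factor \<open>exp (K * t)\<close> turns \<open>bound\<close>
    into monotonicity on \<open>{a..c}\<close>: before \<open>c\<close> the function
    \<open>u\<close> is positive, so \<open>bound\<close> applies there.\<close>
  have "u a * exp (K * a) \<le> u c * exp (K * c)"
  proof (rule DERIV_nonneg_imp_increasing_open[where f = "\<lambda>t. u t * exp (K * t)"])
    show "a \<le> c"
      using c by simp
    show "continuous_on {a..c} (\<lambda>t. u t * exp (K * t))"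
      using c by (intro continuous_intros continuous_on_subset[OF cont]) auto
    fix t assume t: "a < t" "t < c"
    have "((\<lambda>t. u t * exp (K * t)) has_real_derivative (u' t + K * u t) * exp (K * t)) (at t)"
      using t c deriv[of t] by (auto intro!: derivative_eq_intros simp: algebra_simps)
    moreover have "(u' t + K * u t) * exp (K * t) \<ge> 0"
      using bound[of t] pos[of t] t c by simp
    ultimately show "\<exists>y. ((\<lambda>t. u t * exp (K * t)) has_real_derivative y) (at t) \<and> y \<ge> 0"
      by blast
  qed
  moreover have "u a * exp (K * a) > 0"
    using \<open>u a > 0\<close> by simp
  moreover have "u c * exp (K * c) \<le> 0"
    using c by (simp add: mult_nonpos_nonneg)
  ultimately show False
    by linarith
qed

theorem lemma2p2:
  fixes \<gamma> \<sigma> \<beta> v v' \<mu> \<mu>' :: "real \<Rightarrow> real"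
  assumes "continuous_on {0..} \<gamma>" and "continuous_on {0..} \<sigma>" and "continuous_on {0..} \<beta>"
    and "\<And>t. t \<ge> 0 \<Longrightarrow> v t \<ge> 0"
    and "\<And>t. t \<ge> 0 \<Longrightarrow> (v has_real_derivative v' t) (at t within {0..})"
    and "\<And>t. t \<ge> 0 \<Longrightarrow> v' t \<le> - \<gamma> t * v t + \<sigma> t * (v t)\<^sup>2 + \<beta> t"
    and "\<And>t. t \<ge> 0 \<Longrightarrow> \<mu> t > 0"
    and "\<And>t. t \<ge> 0 \<Longrightarrow> (\<mu> has_real_derivative \<mu>' t) (at t within {0..})"
    and "continuous_on {0..} \<mu>'"
    and "\<And>t. t \<ge> 0 \<Longrightarrow> 0 \<le> \<sigma> t"
    and "\<And>t. t \<ge> 0 \<Longrightarrow> \<sigma> t \<le> \<mu> t / 2 * (\<gamma> t - \<mu>' t / \<mu> t)"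
    and "\<And>t. t \<ge> 0 \<Longrightarrow> \<beta> t \<le> 1 / (2 * \<mu> t) * (\<gamma> t - \<mu>' t / \<mu> t)"
    and "\<mu> 0 * v 0 < 1"
  shows "\<forall>t\<ge>0. v t < 1 / \<mu> t"
proof (intro allI impI)
  fix T :: real
  assume T: "T \<ge> 0"
  define a where "a = (\<lambda>t. \<gamma> t - \<mu>' t / \<mu> t)"
  define u where "u = (\<lambda>t. 1 - \<mu> t * v t)"
  define u' where "u' = (\<lambda>t. - (\<mu>' t * v t + \<mu> t * v' t))"

  \<comment> \<open>The lower and upper bounds on \<sigma> enclose \<open>\<mu> t / 2 * a t\<close>
    from below by 0, and \<mu> is positive.\<close>
  have a_nonneg: "a t \<ge> 0" if "t \<ge> 0" for t
  proof -
    have "0 \<le> \<mu> t / 2 * a t"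
      unfolding a_def using assms(10,11) that order_trans by blast
    then show ?thesis
      using assms(7)[OF that] by (simp add: zero_le_mult_iff)
  qed

  have cont_\<mu>: "continuous_on {0..} \<mu>" and cont_v: "continuous_on {0..} v"
    using assms(5,8) by (auto intro!: DERIV_continuous_on)
  have "continuous_on {0..} a"
    unfolding a_def using assms(7)
    by (intro continuous_intros assms(1,9) cont_\<mu>) (auto simp: less_imp_neq[symmetric])
  then have "continuous_on {0..T} a"
    by (rule continuous_on_subset) auto
  \<comment> \<open>\<open>M\<close> may depend on \<open>T\<close>, since positivity of
    \<open>u\<close> is needed only at the fixed time \<open>T\<close>; the comparison constant will
    be \<open>M / 2\<close>.\<close>
  then obtain M where M: "\<And>t. t \<in> {0..T} \<Longrightarrow> a t \<le> M"
    using continuous_attains_sup[of "{0..T}" a] T by fastforce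

  \<comment> \<open>With \<open>w = \<mu> v\<close>, substituting
    \<open>\<mu>' = \<mu> (\<gamma> - a)\<close> cancels the \<gamma> terms, and the bounds on
    \<sigma> and \<beta> complete the square: \<open>w' \<le> - a w + (a / 2) w\<^sup>2 + a / 2 = (a
    / 2) (1 - w)\<^sup>2\<close>.\<close>
  have quadratic: "u' t \<ge> - (a t / 2) * (u t)\<^sup>2" if t: "t \<ge> 0" for t
  proof -
    have \<mu>: "\<mu> t > 0"
      using assms(7) t by simp
    have "\<mu> t * v' t \<le> \<mu> t * (- \<gamma> t * v t + \<sigma> t * (v t)\<^sup>2 + \<beta> t)"
      using assms(6)[OF t] \<mu> by (intro mult_left_mono) auto
    moreover have "\<mu> t * (\<sigma> t * (v t)\<^sup>2) \<le> \<mu> t * (\<mu> t / 2 * a t * (v t)\<^sup>2)"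
      unfolding a_def using assms(11)[OF t] \<mu> by (intro mult_left_mono mult_right_mono) auto
    moreover have "\<mu> t * \<beta> t \<le> a t / 2"
      unfolding a_def using mult_left_mono[OF assms(12)[OF t], of "\<mu> t"] \<mu> by simp
    moreover have "\<mu>' t * v t = (\<mu> t * \<gamma> t - \<mu> t * a t) * v t"
      using \<mu> by (simp add: a_def right_diff_distrib)
    ultimately show ?thesis
      unfolding u'_def u_def by (simp add: algebra_simps power2_eq_square)
  qed

  have "u T > 0"
  proof (rule positive_of_linear_lower_bound[where u = u and u' = u' and a = 0 and b = T and K = "M / 2"])
    show "continuous_on {0..T} u"
      unfolding u_def
      by (intro continuous_intros continuous_on_subset[OF cont_\<mu>] continuous_on_subset[OF cont_v]) auto
    show "0 \<le> T" "u 0 > 0"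
      using T assms(13) by (simp_all add: u_def)
    fix t assume t: "0 < t" "t < T"
    \<comment> \<open>Away from 0 the derivatives within the half-line are two-sided, as the
      comparison lemma expects.\<close>
    have "at t within {0..} = at t"
      using t by (intro at_within_open_subset[of _ "{0<..}"]) auto
    then have "(\<mu> has_real_derivative \<mu>' t) (at t)" "(v has_real_derivative v' t) (at t)"
      using assms(5)[of t] assms(8)[of t] t by auto
    then show "(u has_real_derivative u' t) (at t)"
      unfolding u_def u'_def by (auto intro!: derivative_eq_intros)
    assume pos: "u t > 0"
    have "u t \<le> 1"
      using assms(4,7)[of t] t by (simp add: u_def)
    then have "(u t)\<^sup>2 \<le> u t"
      using pos by (simp add: power2_eq_square)
    \<comment> \<open>Multiplying the two estimates needs \<open>M \<ge> 0\<close>, which follows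
      from \<open>0 \<le> a t \<le> M\<close>.\<close>
    then have "a t / 2 * (u t)\<^sup>2 \<le> M / 2 * u t"
      using M[of t] a_nonneg[of t] t pos by (intro mult_mono) auto
    then show "u' t \<ge> - (M / 2) * u t"
      using quadratic[of t] t by simp
  qed
  then show "v T < 1 / \<mu> T"
    using assms(7)[OF T] by (simp add: u_def field_simps)
qed

end
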